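(* Let $\mathcal G$ be a connected weighted graph on $n\ge2$ nodes, and let $\mathfrak T(\mathcal G)=\sum_{\mathcal T}\prod_{e\in\mathcal E_{\mathcal T}}w_{\mathcal G}(e)$ be its weighted number of spanning trees, the sum running over all spanning trees $\mathcal T$ of $\mathcal G$ (with edge set $\mathcal E_{\mathcal T}$). Then $$\rho_{ss}(L_{\mathcal G};M_n)\ \ge\ \frac{n-1}{2\,\sqrt[n-1]{n\,\mathfrak T(\mathcal G)}}.$$
   Context: Graphs are finite, simple, undirected, with positive edge weights $w_{\mathcal G}(e)$. The Laplacian $L_{\mathcal G}$ is (diagonal matrix of weighted degrees) minus (weighted adjacency matrix), with eigenvalues $0=\lambda_1<\lambda_2\le\dots\le\lambda_n$. $M_n=I_n-\frac1nJ_n$ is the centering matrix, and $\rho_{ss}(L_{\mathcal G};M_n)=\frac12\sum_{i=2}^n\lambda_i^{-1}$ is the performance measure of the first-order consensus network $\dot x=-L_{\mathcal G}x+\xi$, $y=M_nx$. *)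

theory Defs
  imports "HOL-Library.Multiset" "HOL-Computational_Algebra.Polynomial"
    "Jordan_Normal_Form.Char_Poly"
begin

text \<open>
  A graph is given by a vertex set together with a set of edges, each edge being a
  two-element set of vertices.
\<close>

definition simple_graph :: "'a set \<Rightarrow> 'a set set \<Rightarrow> bool" where
  "simple_graph V E \<longleftrightarrow> finite V \<and> (\<forall>e\<in>E. \<exists>u\<in>V. \<exists>v\<in>V. u \<noteq> v \<and> e = {u, v})"

definition connected_graph :: "'a set \<Rightarrow> 'a set set \<Rightarrow> bool" where
  "connected_graph V E \<longleftrightarrow> V \<noteq> {} \<and> (\<forall>u\<in>V. \<forall>v\<in>V. (u, v) \<in> {(x, y). {x, y} \<in> E}\<^sup>*)"

definition graph_cycle :: "'a set set \<Rightarrow> 'a list \<Rightarrow> bool" where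
  "graph_cycle E c \<longleftrightarrow> 3 \<le> length c \<and> distinct c \<and>
     (\<forall>i < length c. {c ! i, c ! (Suc i mod length c)} \<in> E)"

definition tree :: "'a set \<Rightarrow> 'a set set \<Rightarrow> bool" where
  "tree V T \<longleftrightarrow> simple_graph V T \<and> connected_graph V T \<and> (\<nexists>c. graph_cycle T c)"

text \<open>A spanning tree contains all vertices, so it is identified with its edge set.\<close>

definition spanning_tree :: "'a set \<Rightarrow> 'a set set \<Rightarrow> 'a set set \<Rightarrow> bool" where
  "spanning_tree V E T \<longleftrightarrow> T \<subseteq> E \<and> tree V T"

definition weighted_graph :: "'a set \<Rightarrow> 'a set set \<Rightarrow> ('a set \<Rightarrow> real) \<Rightarrow> bool" where
  "weighted_graph V E w \<longleftrightarrow> simple_graph V E \<and> (\<forall>e\<in>E. 0 < w e)"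

definition weighted_tree_number :: "'a set \<Rightarrow> 'a set set \<Rightarrow> ('a set \<Rightarrow> real) \<Rightarrow> real" where
  "weighted_tree_number V E w = (\<Sum>T | spanning_tree V E T. \<Prod>e\<in>T. w e)"

text \<open>
  For the matrices of a graph on \<open>n\<close> vertices, the vertices are labelled \<open>0, \<dots>, n - 1\<close>,
  in accordance with the matrix indices.
\<close>

definition adjacency_matrix :: "nat \<Rightarrow> nat set set \<Rightarrow> (nat set \<Rightarrow> real) \<Rightarrow> real mat" where
  "adjacency_matrix n E w = mat n n (\<lambda>(i, j). if {i, j} \<in> E then w {i, j} else 0)"

definition degree_matrix :: "nat \<Rightarrow> nat set set \<Rightarrow> (nat set \<Rightarrow> real) \<Rightarrow> real mat" where
  "degree_matrix n E w =
     mat n n (\<lambda>(i, j). if i = j then (\<Sum>e | e \<in> E \<and> i \<in> e. w e) else 0)"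

definition laplacian :: "nat \<Rightarrow> nat set set \<Rightarrow> (nat set \<Rightarrow> real) \<Rightarrow> real mat" where
  "laplacian n E w = degree_matrix n E w - adjacency_matrix n E w"

text \<open>
  The \<open>i\<close>-th smallest eigenvalue (\<open>1 \<le> i \<le> n\<close>), counted with multiplicity.  Only the real
  roots of the characteristic polynomial are listed; for a real symmetric matrix such as a
  Laplacian these are all \<open>n\<close> roots, and algebraic and geometric multiplicities agree.
\<close>

definition eigval :: "real mat \<Rightarrow> nat \<Rightarrow> real" where
  "eigval A i = sorted_list_of_multiset (proots (char_poly A)) ! (i - 1)"

text \<open>
  The performance measure \<open>\<rho>\<^sub>s\<^sub>s(L; M\<^sub>n)\<close> of the first-order consensus network with state
  matrix \<open>- L\<close> and output \<open>y = M\<^sub>n x\<close>, where \<open>M\<^sub>n = I\<^sub>n - J\<^sub>n / n\<close>.  The output matrix being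
  the centering matrix is what restricts the sum to the indices \<open>i \<ge> 2\<close>.
\<close>

definition rho_ss_centering :: "real mat \<Rightarrow> real" where
  "rho_ss_centering L = 1 / 2 * (\<Sum>i = 2..dim_row L. inverse (eigval L i))"

end

theory Submission
  imports Defs "HOL-Analysis.Convex"
begin

text \<open>
  The nonzero eigenvalues \<open>\<lambda>\<^sub>2, \<dots>, \<lambda>\<^sub>n\<close> of the Laplacian of a connected graph are positive and their
  product is \<open>n\<close> times the weighted number of spanning trees.  The bound is then the inequality of
  arithmetic and geometric means for their reciprocals (\<open>sum_list_inverse_ge\<close>).

  The product formula (\<open>laplacian_spectrum\<close>) has two sources.  On the spectral side, the Laplacian
  is symmetric and positive semidefinite, so its characteristic polynomial splits into real linear
  factors with nonnegative roots, and 0 is a root.  Hence the linear coefficient is, up to sign, the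
  product of the other roots; it is also, up to sign, the sum of the \<open>n\<close> principal minors of size
  \<open>n - 1\<close>.  On the combinatorial side, \<open>matrix_tree\<close> identifies each of these minors with the
  weighted number of spanning trees.  As a connected graph has a spanning tree, the product is not 0,
  which also shows that 0 is a simple eigenvalue.

  The matrix-tree theorem is proved in a form with arbitrary root sets: for a set \<open>S\<close> of vertices,
  the principal minor of the Laplacian on \<open>S\<close> is the sum, over all forests that join every
  vertex of \<open>S\<close> to exactly one vertex outside \<open>S\<close>, of the products of the edge weights
  (\<open>det_grounded_laplacian\<close>).  In this generality deletion and contraction of an edge between \<open>S\<close>
  and its complement stays within simple graphs, because contracting the edge amounts to removing
  its endpoint from \<open>S\<close>.
\<close>

section \<open>Leaving a vertex set along edges\<close>

definition adj :: "'a set set \<Rightarrow> ('a \<times> 'a) set" where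
  "adj E = {(x, y). {x, y} \<in> E}"

lemma adj_iff: "(x, y) \<in> adj E \<longleftrightarrow> {x, y} \<in> E"
  by (simp add: adj_def)

lemma adj_mono: "E \<subseteq> F \<Longrightarrow> (adj E)\<^sup>* \<subseteq> (adj F)\<^sup>*"
  by (rule rtrancl_mono) (auto simp: adj_iff)

lemma adj_rtrancl_sym: "(x, y) \<in> (adj E)\<^sup>* \<Longrightarrow> (y, x) \<in> (adj E)\<^sup>*"
  by (rule symD[OF sym_rtrancl]) (auto intro: symI simp: adj_def insert_commute)

text \<open>
  The complement of \<open>S\<close> acts as a set of roots.  Keeping the root set variable, instead of
  working with a single root, makes the deletion of an edge recursive: an edge that is
  used to leave \<open>S\<close> can be removed at the price of declaring its inner endpoint a root.
\<close>

definition reaches_outside :: "'a set set \<Rightarrow> 'a set \<Rightarrow> bool" where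
  "reaches_outside E S \<longleftrightarrow> (\<forall>v\<in>S. \<exists>r. r \<notin> S \<and> (v, r) \<in> (adj E)\<^sup>*)"

lemma crossing_edge:
  assumes "reaches_outside E S" "S \<noteq> {}"
  obtains r v where "r \<notin> S" "v \<in> S" "{r, v} \<in> E"
proof -
  from assms obtain v r where "v \<in> S" "r \<notin> S" "(v, r) \<in> (adj E)\<^sup>*"
    unfolding reaches_outside_def by blast
  from this(3,1,2) have "\<exists>x y. x \<notin> S \<and> y \<in> S \<and> {x, y} \<in> E"
  proof (induction rule: converse_rtrancl_induct)
    case (step y z)
    thus ?case by (cases "z \<in> S") (auto simp: adj_iff insert_commute[of y z])
  qed auto
  with that show ?thesis by blast
qed

text \<open>
  A walk that leaves \<open>S\<close> either avoids the deleted edge or meets one of its endpoints first;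
  after \<open>v\<close> has been made a root, both endpoints are roots, so the walk may stop there.
\<close>

lemma reaches_outside_delete:
  assumes "reaches_outside F S" "r \<notin> S" "v \<in> S"
  shows "reaches_outside (F - {{r, v}}) (S - {v})"
  unfolding reaches_outside_def
proof
  fix u assume "u \<in> S - {v}"
  with assms obtain x where x: "(u, x) \<in> (adj F)\<^sup>*" "x \<notin> S"
    unfolding reaches_outside_def by blast
  from x(1) show "\<exists>y. y \<notin> S - {v} \<and> (u, y) \<in> (adj (F - {{r, v}}))\<^sup>*"
  proof (induction rule: converse_rtrancl_induct)
    case base
    with x(2) show ?case by blast
  next
    case (step u u')
    show ?case
    proof (cases "{u, u'} = {r, v}")
      case True
      hence "u \<notin> S - {v}" using assms(2) by (auto simp: doubleton_eq_iff)
      thus ?thesis by blast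
    next
      case False
      hence "(u, u') \<in> adj (F - {{r, v}})" using step(1) by (auto simp: adj_iff)
      with step.IH show ?thesis by (meson converse_rtrancl_into_rtrancl)
    qed
  qed
qed

lemma reaches_outside_insert:
  assumes "reaches_outside F (S - {v})" "r \<notin> S"
  shows "reaches_outside (insert {r, v} F) S"
  unfolding reaches_outside_def
proof
  let ?F = "insert {r, v} F"
  fix u assume "u \<in> S"
  have vr: "(v, r) \<in> (adj ?F)\<^sup>*" by (auto simp: adj_iff insert_commute)
  have "\<exists>y. y \<notin> S - {v} \<and> (u, y) \<in> (adj F)\<^sup>*"
    using assms(1) unfolding reaches_outside_def by blast
  then obtain y where "y \<notin> S \<or> y = v" "(u, y) \<in> (adj F)\<^sup>*" by blast
  moreover from this(2) have "(u, y) \<in> (adj ?F)\<^sup>*" using adj_mono[of F ?F] by blast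
  ultimately show "\<exists>x. x \<notin> S \<and> (u, x) \<in> (adj ?F)\<^sup>*"
    using vr assms(2) by (meson rtrancl_trans)
qed

section \<open>Forests with prescribed roots\<close>

text \<open>
  For finite \<open>E\<close> and \<open>S\<close> these are the forests in which every component contains exactly one
  vertex outside \<open>S\<close>, where a vertex on no edge is a component by itself.  Counting edges takes
  the place of acyclicity and of the uniqueness of the root: leaving \<open>S\<close> from each of its
  vertices takes at least \<open>card S\<close> edges, and a cycle or a path between two roots would cost an
  additional one.
\<close>

definition rooted_forests :: "'a set set \<Rightarrow> 'a set \<Rightarrow> 'a set set set" where
  "rooted_forests E S = {F. F \<subseteq> E \<and> card F = card S \<and> reaches_outside F S}"

lemma finite_rooted_forests: "finite E \<Longrightarrow> finite (rooted_forests E S)"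
  by (rule finite_subset[of _ "Pow E"]) (auto simp: rooted_forests_def)

lemma rooted_forests_empty: "finite E \<Longrightarrow> rooted_forests E {} = {{}}"
  by (auto simp: rooted_forests_def reaches_outside_def dest: finite_subset)

text \<open>
  Deletion and contraction of an edge that crosses the boundary of \<open>S\<close>.  Contracting the edge into
  the root set means enlarging the root set by \<open>v\<close>, so no multigraph arises.
\<close>

lemma rooted_forests_split:
  assumes "finite E" "finite S" "r \<notin> S" "v \<in> S" "{r, v} \<in> E"
  shows "rooted_forests E S = rooted_forests (E - {{r, v}}) S \<union>
    insert {r, v} ` rooted_forests (E - {{r, v}}) (S - {v})" (is "?L = ?A \<union> insert ?e ` ?B")
proof (intro equalityI subsetI)
  fix F assume F: "F \<in> ?L"
  show "F \<in> ?A \<union> insert ?e ` ?B"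
  proof (cases "?e \<in> F")
    case False
    with F show ?thesis by (auto simp: rooted_forests_def)
  next
    case True
    have "card (F - {?e}) = card (S - {v})"
      using F assms(4) True by (simp add: rooted_forests_def)
    hence "F - {?e} \<in> ?B"
      using F reaches_outside_delete[of F S r v] assms(3,4) by (auto simp: rooted_forests_def)
    moreover have "F = insert ?e (F - {?e})" using True by blast
    ultimately show ?thesis by blast
  qed
next
  fix F assume "F \<in> ?A \<union> insert ?e ` ?B"
  thus "F \<in> ?L"
  proof
    assume "F \<in> ?A"
    thus ?thesis by (auto simp: rooted_forests_def)
  next
    assume "F \<in> insert ?e ` ?B"
    then obtain F' where F': "F = insert ?e F'" "F' \<in> ?B" by blast
    have fin: "finite F'" and e: "?e \<notin> F'"
      using F'(2) assms(1) by (auto simp: rooted_forests_def dest: finite_subset)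
    have "card F = card S"
      using F' fin e assms(2,4) card_Suc_Diff1[of S v] by (simp add: rooted_forests_def)
    thus ?thesis
      using F' reaches_outside_insert[of F' S v r] assms(3,5) by (auto simp: rooted_forests_def)
  qed
qed

lemma rooted_forests_nonempty:
  assumes "finite S" "finite E" "reaches_outside E S"
  shows "rooted_forests E S \<noteq> {}"
  using assms
proof (induction "card S" arbitrary: S E)
  case 0
  thus ?case by (simp add: rooted_forests_empty)
next
  case (Suc k)
  hence "S \<noteq> {}" by auto
  with Suc.prems obtain r v where rv: "r \<notin> S" "v \<in> S" "{r, v} \<in> E"
    using crossing_edge by metis
  have "rooted_forests (E - {{r, v}}) (S - {v}) \<noteq> {}"
    using Suc.hyps Suc.prems rv reaches_outside_delete[of E S r v] by (intro Suc.hyps(1)) auto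
  thus ?case using rooted_forests_split[of E S r v] Suc.prems rv by blast
qed

text \<open>
  The edges of a rooted forest inside \<open>F\<close> already number \<open>card S\<close>; for a single root this says
  that a connected graph on \<open>n\<close> vertices has at least \<open>n - 1\<close> edges.
\<close>

lemma reaches_outside_card_le:
  assumes "finite S" "finite F" "reaches_outside F S"
  shows "card S \<le> card F"
proof -
  obtain G where "G \<in> rooted_forests F S" using rooted_forests_nonempty[OF assms] by blast
  thus ?thesis using card_mono[OF assms(2), of G] by (simp add: rooted_forests_def)
qed

section \<open>Spanning trees as rooted forests\<close>

lemma connected_graph_iff_reaches_root:
  assumes "simple_graph V T" "r \<in> V"
  shows "connected_graph V T \<longleftrightarrow> reaches_outside T (V - {r})"
proof
  assume "connected_graph V T"
  hence "(v, r) \<in> (adj T)\<^sup>*" if "v \<in> V" for v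
    using that assms(2) by (simp add: connected_graph_def adj_def)
  thus "reaches_outside T (V - {r})" unfolding reaches_outside_def by blast
next
  assume reach: "reaches_outside T (V - {r})"
  have stay: "y \<in> V" if "(x, y) \<in> (adj T)\<^sup>*" "x \<in> V" for x y
    using that by (induction rule: rtrancl_induct)
      (use assms(1) in \<open>auto simp: simple_graph_def adj_iff doubleton_eq_iff\<close>)
  have to_root: "(x, r) \<in> (adj T)\<^sup>*" if "x \<in> V" for x
  proof (cases "x = r")
    case False
    with reach that obtain y where "y \<notin> V - {r}" "(x, y) \<in> (adj T)\<^sup>*"
      unfolding reaches_outside_def by blast
    with stay[of x y] that show ?thesis by auto
  qed auto
  have "(x, y) \<in> (adj T)\<^sup>*" if "x \<in> V" "y \<in> V" for x y
    using to_root[OF that(1)] adj_rtrancl_sym[OF to_root[OF that(2)]] by (rule rtrancl_trans)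
  thus "connected_graph V T"
    using assms(2) unfolding connected_graph_def adj_def[symmetric] by blast
qed

text \<open>
  The rest of the cycle is a detour around its first edge, since in a cycle of length at least
  three no other edge coincides with the first one.
\<close>

lemma cycle_edge_detour:
  assumes "graph_cycle T c"
  shows "{c ! 0, c ! 1} \<in> T" "(c ! 1, c ! 0) \<in> (adj (T - {{c ! 0, c ! 1}}))\<^sup>*"
proof -
  let ?n = "length c" and ?T = "T - {{c ! 0, c ! 1}}"
  have n: "3 \<le> ?n" and dist: "distinct c"
    and edge: "\<And>i. i < ?n \<Longrightarrow> {c ! i, c ! (Suc i mod ?n)} \<in> T"
    using assms by (auto simp: graph_cycle_def)
  have inj: "c ! i = c ! j \<longleftrightarrow> i = j" if "i < ?n" "j < ?n" for i j
    using that dist nth_eq_iff_index_eq by blast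
  show "{c ! 0, c ! 1} \<in> T"
  proof -
    have "Suc 0 mod ?n = 1" "0 < ?n" using n by (simp, linarith)
    with edge[of 0] show ?thesis by metis
  qed
  have step: "(c ! i, c ! (Suc i mod ?n)) \<in> adj ?T" if "1 \<le> i" "i < ?n" for i
  proof -
    have "Suc i mod ?n < ?n" using n by (intro mod_less_divisor) linarith
    moreover have "\<not> (i = 1 \<and> Suc i mod ?n = 0)" using n by auto
    ultimately have "{c ! i, c ! (Suc i mod ?n)} \<noteq> {c ! 0, c ! 1}"
      using that inj[of i 0] inj[of i 1] inj[of "Suc i mod ?n" 0] n
      by (cases "i = 1") (auto simp: doubleton_eq_iff simp del: mod_less_divisor length_greater_0_conv)
    with edge[OF that(2)] show ?thesis by (simp add: adj_iff)
  qed
  have "Suc k < ?n \<Longrightarrow> (c ! 1, c ! Suc k) \<in> (adj ?T)\<^sup>*" for k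
  proof (induction k)
    case (Suc k)
    thus ?case using step[of "Suc k"] by (auto intro: rtrancl_into_rtrancl)
  qed auto
  moreover have "Suc (?n - 2) = ?n - 1" "?n - 1 < ?n" using n by auto
  ultimately have "(c ! 1, c ! (?n - 1)) \<in> (adj ?T)\<^sup>*" by metis
  moreover have "(c ! (?n - 1), c ! 0) \<in> adj ?T"
  proof -
    have "Suc (?n - 1) = ?n" using n by linarith
    hence "1 \<le> ?n - 1" "?n - 1 < ?n" "Suc (?n - 1) mod ?n = 0" using n by auto
    with step[of "?n - 1"] show ?thesis by metis
  qed
  ultimately show "(c ! 1, c ! 0) \<in> (adj ?T)\<^sup>*" by (rule rtrancl_into_rtrancl)
qed

lemma connected_delete_detour:
  assumes "connected_graph V T" "(b, a) \<in> (adj (T - {{a, b}}))\<^sup>*"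
  shows "connected_graph V (T - {{a, b}})"
proof -
  have "adj T \<subseteq> (adj (T - {{a, b}}))\<^sup>*"
  proof (intro subsetI, clarify)
    fix x y assume xy: "(x, y) \<in> adj T"
    show "(x, y) \<in> (adj (T - {{a, b}}))\<^sup>*"
    proof (cases "{x, y} = {a, b}")
      case True
      hence "x = a \<and> y = b \<or> x = b \<and> y = a" by (simp add: doubleton_eq_iff)
      thus ?thesis using assms(2) adj_rtrancl_sym[OF assms(2)] by blast
    next
      case False
      hence "(x, y) \<in> adj (T - {{a, b}})" using xy by (simp add: adj_iff)
      thus ?thesis ..
    qed
  qed
  hence "(adj T)\<^sup>* \<subseteq> (adj (T - {{a, b}}))\<^sup>*" by (metis rtrancl_subset_rtrancl)
  thus ?thesis using assms(1) unfolding connected_graph_def adj_def[symmetric] by blast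
qed

lemma adj_rtrancl_imp_path:
  assumes "(x, y) \<in> (adj F)\<^sup>*"
  shows "\<exists>p. p \<noteq> [] \<and> hd p = x \<and> last p = y \<and> distinct p \<and>
    (\<forall>i. Suc i < length p \<longrightarrow> {p ! i, p ! Suc i} \<in> F)"
  using assms
proof (induction rule: rtrancl_induct)
  case base
  show ?case by (rule exI[of _ "[x]"]) auto
next
  case (step y z)
  then obtain p where p: "p \<noteq> []" "hd p = x" "last p = y" "distinct p"
    "\<And>i. Suc i < length p \<Longrightarrow> {p ! i, p ! Suc i} \<in> F" by blast
  show ?case
  proof (cases "z \<in> set p")
    case True
    then obtain k where k: "k < length p" "p ! k = z" by (auto simp: in_set_conv_nth)
    \<comment> \<open>A walk that returns to an earlier vertex of the path is cut back to it.\<close>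
    let ?q = "take (Suc k) p"
    have "last ?q = z" using k by (simp add: take_Suc_conv_app_nth)
    moreover have "hd ?q = x" using p by (simp add: hd_take)
    ultimately show ?thesis using p k by (intro exI[of _ ?q]) auto
  next
    case False
    have "{(p @ [z]) ! i, (p @ [z]) ! Suc i} \<in> F" if "Suc i < length (p @ [z])" for i
    proof (cases "Suc i < length p")
      case True
      with p(5) show ?thesis by (simp add: nth_append)
    next
      case False
      hence "Suc i = length p" using that by simp
      hence "p ! i = y" using p(1,3) by (metis diff_Suc_1 last_conv_nth)
      thus ?thesis using step(2) \<open>Suc i = length p\<close> by (simp add: nth_append adj_iff)
    qed
    thus ?thesis using p False by (intro exI[of _ "p @ [z]"]) auto
  qed
qed

lemma extra_edge_closes_cycle:
  assumes "F \<subseteq> T" "{a, b} \<in> T" "{a, b} \<notin> F" "a \<noteq> b" "(a, b) \<in> (adj F)\<^sup>*"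
  shows "\<exists>c. graph_cycle T c"
proof -
  obtain p where p: "p \<noteq> []" "hd p = a" "last p = b" "distinct p"
    "\<And>i. Suc i < length p \<Longrightarrow> {p ! i, p ! Suc i} \<in> F"
    using adj_rtrancl_imp_path[OF assms(5)] by blast
  have ends: "p ! 0 = a" "p ! (length p - 1) = b"
    using p by (simp_all add: hd_conv_nth last_conv_nth)
  have "length p \<noteq> 1" using ends assms(4) by auto
  moreover have "length p \<noteq> 2" using ends p(5)[of 0] assms(3) by auto
  moreover have "length p \<noteq> 0" using p(1) by simp
  ultimately have len: "3 \<le> length p" by linarith
  have "{p ! i, p ! (Suc i mod length p)} \<in> T" if "i < length p" for i
  proof (cases "Suc i < length p")
    case True
    with p(5) assms(1) show ?thesis by auto
  next
    case False
    hence "Suc i = length p" using that by simp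
    hence "i = length p - 1" by simp
    thus ?thesis using ends assms(2) \<open>Suc i = length p\<close> by (simp add: insert_commute)
  qed
  with len p(4) have "graph_cycle T p" by (simp add: graph_cycle_def)
  thus ?thesis ..
qed

lemma simple_graph_finite_edges: "simple_graph V E \<Longrightarrow> finite E"
  by (rule finite_subset[of _ "Pow V"]) (auto simp: simple_graph_def)

lemma simple_graph_subset: "simple_graph V E \<Longrightarrow> F \<subseteq> E \<Longrightarrow> simple_graph V F"
  by (auto simp: simple_graph_def)

text \<open>
  Both inclusions compare a tree with a rooted forest inside it.  A spanning tree contains a
  connected rooted forest, and any further edge would close a cycle with it.  Conversely, a
  rooted forest has the least number of edges that keeps the graph connected, so it has no cycle, as
  an edge on a cycle could be dropped.
\<close>

lemma spanning_trees_are_rooted_forests: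
  assumes G: "simple_graph V E" and r: "r \<in> V"
  shows "{T. spanning_tree V E T} = rooted_forests E (V - {r})"
proof (intro equalityI subsetI CollectI)
  fix T assume "T \<in> {T. spanning_tree V E T}"
  hence T: "T \<subseteq> E" "simple_graph V T" "connected_graph V T" "\<nexists>c. graph_cycle T c"
    unfolding spanning_tree_def tree_def by blast+
  have fin: "finite (V - {r})" "finite T"
    using T(2) simple_graph_finite_edges[OF T(2)] by (auto simp: simple_graph_def)
  have reach: "reaches_outside T (V - {r})"
    using connected_graph_iff_reaches_root[OF T(2) r] T(3) by simp
  from rooted_forests_nonempty[OF fin this] obtain F where F: "F \<in> rooted_forests T (V - {r})"
    by blast
  hence FT: "F \<subseteq> T" by (simp add: rooted_forests_def)
  have conn: "connected_graph V F"
    using F simple_graph_subset[OF T(2) FT] r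
    by (simp add: connected_graph_iff_reaches_root rooted_forests_def)
  have "F = T"
  proof (rule ccontr)
    assume "F \<noteq> T"
    then obtain e where e: "e \<in> T" "e \<notin> F" using FT by blast
    then obtain a b where ab: "a \<in> V" "b \<in> V" "a \<noteq> b" "e = {a, b}"
      using T(2) by (auto simp: simple_graph_def)
    have "(a, b) \<in> (adj F)\<^sup>*" using conn ab by (auto simp: connected_graph_def adj_def)
    thus False using extra_edge_closes_cycle[OF FT, of a b] e ab T(4) by simp
  qed
  thus "T \<in> rooted_forests E (V - {r})" using F T(1) by (auto simp: rooted_forests_def)
next
  fix T assume "T \<in> rooted_forests E (V - {r})"
  hence T: "T \<subseteq> E" "card T = card (V - {r})" "reaches_outside T (V - {r})"
    by (auto simp: rooted_forests_def)
  have sT: "simple_graph V T" using G T(1) by (rule simple_graph_subset)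
  have conn: "connected_graph V T" using connected_graph_iff_reaches_root[OF sT r] T(3) by simp
  have "\<not> graph_cycle T c" for c
  proof
    assume c: "graph_cycle T c"
    let ?e = "{c ! 0, c ! 1}"
    have "connected_graph V (T - {?e})"
      using connected_delete_detour[OF conn] cycle_edge_detour(2)[OF c] by simp
    hence "reaches_outside (T - {?e}) (V - {r})"
      using connected_graph_iff_reaches_root[OF simple_graph_subset[OF sT] r] by auto
    hence "card (V - {r}) \<le> card (T - {?e})"
      using sT simple_graph_finite_edges[OF sT]
      by (intro reaches_outside_card_le) (auto simp: simple_graph_def)
    moreover have "card (T - {?e}) < card T"
      using cycle_edge_detour(1)[OF c] simple_graph_finite_edges[OF sT] by (metis card_Diff1_less)
    ultimately show False using T(2) by simp
  qed
  thus "spanning_tree V E T" using T(1) sT conn by (auto simp: spanning_tree_def tree_def)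
qed

section \<open>Weighted sums over rooted forests\<close>

definition forest_sum :: "'a set set \<Rightarrow> ('a set \<Rightarrow> real) \<Rightarrow> 'a set \<Rightarrow> real" where
  "forest_sum E w S = (\<Sum>F\<in>rooted_forests E S. \<Prod>e\<in>F. w e)"

lemma forest_sum_split:
  assumes "finite E" "finite S" "r \<notin> S" "v \<in> S" "{r, v} \<in> E"
  shows "forest_sum E w S = forest_sum (E - {{r, v}}) w S
    + w {r, v} * forest_sum (E - {{r, v}}) w (S - {v})"
proof -
  let ?e = "{r, v}"
  let ?A = "rooted_forests (E - {?e}) S" and ?B = "rooted_forests (E - {?e}) (S - {v})"
  have fin: "finite (rooted_forests (E - {?e}) X)" for X
    using assms(1) by (simp add: finite_rooted_forests)
  have B: "?e \<notin> F \<and> finite F" if "F \<in> ?B" for F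
    using that assms(1) by (auto simp: rooted_forests_def dest: finite_subset)
  have inj: "inj_on (insert ?e) ?B"
    using B by (intro inj_onI) (metis insert_ident)
  have "?A \<inter> insert ?e ` ?B = {}" by (auto simp: rooted_forests_def)
  hence "forest_sum E w S = forest_sum (E - {?e}) w S + (\<Sum>F\<in>insert ?e ` ?B. \<Prod>e\<in>F. w e)"
    unfolding forest_sum_def rooted_forests_split[OF assms]
    using fin by (intro sum.union_disjoint) auto
  also have "(\<Sum>F\<in>insert ?e ` ?B. \<Prod>e\<in>F. w e) = (\<Sum>F\<in>?B. w ?e * (\<Prod>e\<in>F. w e))"
    unfolding sum.reindex[OF inj] comp_def using B by (intro sum.cong) auto
  finally show ?thesis by (simp add: forest_sum_def sum_distrib_left)
qed

lemma weighted_tree_number_eq_forest_sum: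
  assumes "simple_graph V E" "r \<in> V"
  shows "weighted_tree_number V E w = forest_sum E w (V - {r})"
  using spanning_trees_are_rooted_forests[OF assms]
  by (simp add: weighted_tree_number_def forest_sum_def)

lemma weighted_tree_number_pos:
  assumes "weighted_graph V E w" "connected_graph V E"
  shows "weighted_tree_number V E w > 0"
proof -
  have G: "simple_graph V E" and w: "\<And>e. e \<in> E \<Longrightarrow> w e > 0"
    using assms(1) by (auto simp: weighted_graph_def)
  obtain r where r: "r \<in> V" using assms(2) by (auto simp: connected_graph_def)
  have fin: "finite E" "finite (V - {r})"
    using G simple_graph_finite_edges[OF G] by (auto simp: simple_graph_def)
  have ne: "rooted_forests E (V - {r}) \<noteq> {}"
    using rooted_forests_nonempty[OF fin(2,1)] connected_graph_iff_reaches_root[OF G r] assms(2)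
    by blast
  show ?thesis
    unfolding weighted_tree_number_eq_forest_sum[OF G r] forest_sum_def
  proof (rule sum_pos)
    show "finite (rooted_forests E (V - {r}))"
      using fin(1) by (rule finite_rooted_forests)
  next
    fix F assume "F \<in> rooted_forests E (V - {r})"
    thus "0 < (\<Prod>e\<in>F. w e)" using w by (intro prod_pos) (auto simp: rooted_forests_def)
  qed (rule ne)
qed

section \<open>The matrix-tree theorem\<close>

lemma laplacian_carrier [simp]: "laplacian n E w \<in> carrier_mat n n"
  by (auto simp: laplacian_def degree_matrix_def adjacency_matrix_def)

lemma degree_eq_sum_neighbours:
  fixes w :: "'a set \<Rightarrow> real"
  assumes "simple_graph V E"
  shows "(\<Sum>e | e \<in> E \<and> i \<in> e. w e) = (\<Sum>j\<in>V. if {i, j} \<in> E then w {i, j} else 0)"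
proof -
  have V: "finite V" using assms by (simp add: simple_graph_def)
  let ?N = "{j \<in> V. {i, j} \<in> E}"
  have img: "{e. e \<in> E \<and> i \<in> e} = (\<lambda>j. {i, j}) ` ?N"
  proof (intro equalityI subsetI)
    fix e assume "e \<in> {e. e \<in> E \<and> i \<in> e}"
    moreover from this obtain a b where "a \<in> V" "b \<in> V" "e = {a, b}"
      using assms by (auto simp: simple_graph_def)
    ultimately show "e \<in> (\<lambda>j. {i, j}) ` ?N" by (auto simp: insert_commute)
  qed auto
  have inj: "inj_on (\<lambda>j. {i, j}) ?N" by (intro inj_onI) (auto simp: doubleton_eq_iff)
  show ?thesis
    unfolding img sum.reindex[OF inj] comp_def using V by (simp add: sum.inter_filter)
qed

lemma laplacian_index:
  assumes "i < n" "j < n"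
  shows "laplacian n E w $$ (i, j) =
    (if i = j then \<Sum>e | e \<in> E \<and> i \<in> e. w e else 0) - (if {i, j} \<in> E then w {i, j} else 0)"
  using assms by (simp add: laplacian_def degree_matrix_def adjacency_matrix_def)

text \<open>
  Replacing the rows outside \<open>S\<close> by unit rows has the same effect on the determinant as
  deleting the rows and columns outside \<open>S\<close>, but the dimension stays \<open>n\<close> when \<open>S\<close> shrinks.
\<close>

definition grounded_laplacian :: "nat \<Rightarrow> nat set set \<Rightarrow> (nat set \<Rightarrow> real) \<Rightarrow> nat set \<Rightarrow> real mat" where
  "grounded_laplacian n E w S = mat n n (\<lambda>(i, j).
     if i \<in> S then laplacian n E w $$ (i, j) else if i = j then 1 else 0)"

lemma grounded_laplacian_carrier [simp]: "grounded_laplacian n E w S \<in> carrier_mat n n"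
  by (simp add: grounded_laplacian_def)

text \<open>
  If no edge leaves \<open>S\<close>, the Laplacian annihilates the indicator vector of \<open>S\<close>.
\<close>

lemma grounded_laplacian_no_crossing:
  assumes G: "simple_graph {0..<n} E" and S: "S \<subseteq> {0..<n}" "S \<noteq> {}"
    and sep: "\<And>r v. r \<notin> S \<Longrightarrow> v \<in> S \<Longrightarrow> {r, v} \<notin> E"
  shows "det (grounded_laplacian n E w S) = 0"
proof -
  let ?M = "grounded_laplacian n E w S"
  define x :: "real vec" where "x = vec n (\<lambda>j. if j \<in> S then 1 else 0)"
  have x: "x \<in> carrier_vec n" by (simp add: x_def)
  obtain s where s: "s \<in> S" "s < n" using S by fastforce
  have "x $ s = 1" using s by (simp add: x_def)
  hence "x \<noteq> 0\<^sub>v n" using s by auto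
  moreover have "?M *\<^sub>v x = 0\<^sub>v n"
  proof (rule eq_vecI)
    fix i assume "i < dim_vec (0\<^sub>v n :: real vec)"
    hence i: "i < n" by simp
    have "(?M *\<^sub>v x) $ i = (\<Sum>j<n. ?M $$ (i, j) * x $ j)"
      using i x by (simp add: scalar_prod_def grounded_laplacian_def atLeast0LessThan)
    also have "\<dots> = 0"
    proof (cases "i \<in> S")
      case False
      have "?M $$ (i, j) * x $ j = 0" if "j < n" for j
        using False i that by (cases "i = j") (simp_all add: grounded_laplacian_def x_def)
      thus ?thesis by (intro sum.neutral) auto
    next
      case True
      let ?d = "\<Sum>e | e \<in> E \<and> i \<in> e. w e"
      let ?a = "\<lambda>j. if {i, j} \<in> E then w {i, j} else 0"
      have "?M $$ (i, j) * x $ j = (if j = i then ?d else 0) - ?a j" if "j < n" for j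
      proof (cases "j \<in> S")
        case j: True
        thus ?thesis using True i that by (simp add: grounded_laplacian_def x_def laplacian_index)
      next
        case False
        hence "{i, j} \<notin> E" using sep[of j i] True by (simp add: insert_commute)
        moreover have "j \<noteq> i" using False True by blast
        ultimately show ?thesis using False that by (simp add: x_def)
      qed
      hence "(\<Sum>j<n. ?M $$ (i, j) * x $ j) = (\<Sum>j<n. (if j = i then ?d else 0) - ?a j)"
        by (intro sum.cong) auto
      also have "\<dots> = ?d - (\<Sum>j<n. ?a j)" using i by (simp add: sum_subtractf)
      also have "\<dots> = 0"
        using degree_eq_sum_neighbours[OF G, of w i] by (simp add: atLeast0LessThan)
      finally show ?thesis .
    qed
    finally show "(?M *\<^sub>v x) $ i = 0\<^sub>v n $ i" using i by simp
  qed (simp add: grounded_laplacian_def)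
  ultimately show ?thesis
    using det_0_iff_vec_prod_zero[OF grounded_laplacian_carrier] x by blast
qed

text \<open>
  Row \<open>r\<close> is left out because it is a unit row of the grounded Laplacian whenever \<open>r\<close> is a root;
  the edge then enters through row \<open>v\<close> alone.
\<close>

lemma laplacian_delete_edge:
  assumes "finite E" "{r, v} \<in> E" "r \<noteq> v" "i < n" "j < n" "i \<noteq> r"
  shows "laplacian n E w $$ (i, j) = laplacian n (E - {{r, v}}) w $$ (i, j)
    + (if i = v then w {r, v} * ((if j = v then 1 else 0) - (if j = r then 1 else 0)) else 0)"
proof (cases "i = v")
  case False
  have "{e. e \<in> E \<and> i \<in> e} = {e. e \<in> E - {{r, v}} \<and> i \<in> e}" using False assms(6) by auto
  hence "(\<Sum>e | e \<in> E \<and> i \<in> e. w e) = (\<Sum>e | e \<in> E - {{r, v}} \<and> i \<in> e. w e)" by simp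
  moreover have "{i, j} \<noteq> {r, v}" using False assms(6) by (auto simp: doubleton_eq_iff)
  ultimately show ?thesis using assms(4,5) False unfolding laplacian_index[OF assms(4,5)] by auto
next
  case True
  let ?e = "{r, v}"
  have "{e \<in> E. v \<in> e} = insert ?e {e \<in> E - {?e}. v \<in> e}" using assms(2) by auto
  hence "(\<Sum>e | e \<in> E \<and> v \<in> e. w e) = w ?e + (\<Sum>e | e \<in> E - {?e} \<and> v \<in> e. w e)"
    using assms(1) by simp
  moreover have "{v, j} = ?e \<longleftrightarrow> j = r" using assms(3) by (auto simp: doubleton_eq_iff)
  moreover have "{v, r} = ?e" by (rule insert_commute)
  ultimately show ?thesis using True assms
    by (auto simp: laplacian_index)
qed

text \<open>
  The edge contributes the summand \<open>w {r, v} * (e\<^sub>v - e\<^sub>r)\<close> to row \<open>v\<close>, where \<open>e\<^sub>i\<close> is the \<open>i\<close>-th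
  unit vector, and the determinant is additive in that row.  In the second determinant, adding a
  multiple of row \<open>r\<close>, which is \<open>e\<^sub>r\<close>, turns row \<open>v\<close> into \<open>w {r, v} * e\<^sub>v\<close>: vertex \<open>v\<close> has become a
  root.
\<close>

lemma det_grounded_laplacian_split:
  assumes "finite E" "S \<subseteq> {0..<n}" "r < n" "r \<notin> S" "v \<in> S" "{r, v} \<in> E"
  shows "det (grounded_laplacian n E w S) = det (grounded_laplacian n (E - {{r, v}}) w S)
    + w {r, v} * det (grounded_laplacian n (E - {{r, v}}) w (S - {v}))"
proof -
  let ?c = "w {r, v}"
  let ?A = "grounded_laplacian n (E - {{r, v}}) w S"
  let ?B = "grounded_laplacian n (E - {{r, v}}) w (S - {v})"
  let ?b = "?c \<cdot>\<^sub>v (unit_vec n v - unit_vec n r)"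
  define C where "C = mat\<^sub>r n n (\<lambda>i. if i = v then ?b else row ?A i)"
  have vn: "v < n" "r \<noteq> v" using assms by auto
  have dim: "dim_row ?A = n" "dim_col ?A = n" by (simp_all add: grounded_laplacian_def)
  have C: "C \<in> carrier_mat n n" by (simp add: C_def)
  define D where "D = mat\<^sub>r n n (\<lambda>i. if i = v then row ?A i + ?b else row ?A i)"
  have "grounded_laplacian n E w S = D"
    unfolding D_def
  proof (rule eq_matI, goal_cases)
    case (1 i j)
    hence ij: "i < n" "j < n" by auto
    show ?case
    proof (cases "i \<in> S")
      case True
      hence "i \<noteq> r" using assms(4) by auto
      from laplacian_delete_edge[OF assms(1,6) vn(2) ij this] True ij assms(3) vn(1) show ?thesis
        by (auto simp: grounded_laplacian_def mat_of_rows_def)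
    next
      case False
      hence "i \<noteq> v" using assms(5) by auto
      with False ij show ?thesis by (simp add: grounded_laplacian_def)
    qed
  qed (simp_all add: grounded_laplacian_def)
  moreover have "det D = det (mat\<^sub>r n n (\<lambda>i. if i = v then row ?A i else row ?A i)) + det C"
    unfolding C_def D_def
    by (rule det_row_add) (use vn in \<open>auto simp: grounded_laplacian_def\<close>)
  moreover have "mat\<^sub>r n n (\<lambda>i. if i = v then row ?A i else row ?A i) = ?A"
    by (rule eq_matI) (simp_all add: dim)
  moreover have "det C = ?c * det ?B"
  proof -
    have "addrow ?c v r C = multrow v ?c ?B"
      by (rule eq_matI) (use vn assms(3-5) in \<open>auto simp: C_def grounded_laplacian_def\<close>)
    moreover have "det (addrow ?c v r C) = det C"
      using vn(2) assms(3) C by (intro det_addrow) auto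
    moreover have "det (multrow v ?c ?B) = ?c * det ?B" using vn(1) by (intro det_multrow) auto
    ultimately show ?thesis by metis
  qed
  ultimately show ?thesis by metis
qed

text \<open>
  The all-minors form of the matrix-tree theorem for principal minors.  Both sides satisfy the same
  recursion over crossing edges, and they agree when no edge crosses: both are 1 for \<open>S = {}\<close>, and
  otherwise both vanish.
\<close>

lemma det_grounded_laplacian:
  assumes "simple_graph {0..<n} E" "S \<subseteq> {0..<n}"
  shows "det (grounded_laplacian n E w S) = forest_sum E w S"
  using simple_graph_finite_edges[OF assms(1)] assms
proof (induction E arbitrary: S rule: finite_psubset_induct)
  case (psubset E)
  show ?case
  proof (cases "\<exists>r v. r \<notin> S \<and> v \<in> S \<and> {r, v} \<in> E")
    case True
    then obtain r v where rv: "r \<notin> S" "v \<in> S" "{r, v} \<in> E" by blast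
    let ?E = "E - {{r, v}}"
    have "r < n" using rv psubset.prems(1) by (auto simp: simple_graph_def doubleton_eq_iff)
    have "?E \<subset> E" using rv by blast
    moreover have "simple_graph {0..<n} ?E" using psubset.prems(1) by (auto intro: simple_graph_subset)
    ultimately have "det (grounded_laplacian n ?E w X) = forest_sum ?E w X" if "X \<subseteq> S" for X
      using psubset.IH[of ?E X] that psubset.prems(2) by blast
    thus ?thesis
      using det_grounded_laplacian_split[OF psubset.hyps(1) psubset.prems(2) \<open>r < n\<close> rv, of w]
        forest_sum_split[OF psubset.hyps(1) finite_subset[OF psubset.prems(2)] rv, of w]
      by simp
  next
    case no_crossing: False
    show ?thesis
    proof (cases "S = {}")
      case True
      have "grounded_laplacian n E w {} = 1\<^sub>m n"
        by (rule eq_matI) (auto simp: grounded_laplacian_def)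
      thus ?thesis using True psubset.hyps(1) by (simp add: forest_sum_def rooted_forests_empty)
    next
      case False
      have "rooted_forests E S = {}"
      proof -
        have "\<not> reaches_outside F S" if "F \<subseteq> E" for F
          using crossing_edge[of F S] no_crossing False that by blast
        thus ?thesis by (auto simp: rooted_forests_def)
      qed
      moreover have "det (grounded_laplacian n E w S) = 0"
        using no_crossing by (intro grounded_laplacian_no_crossing psubset.prems False) blast
      ultimately show ?thesis by (simp add: forest_sum_def)
    qed
  qed
qed

lemma det_laplacian:
  assumes "simple_graph {0..<n} E" "n > 0"
  shows "det (laplacian n E w) = 0"
proof -
  have "laplacian n E w = grounded_laplacian n E w {0..<n}"
    by (rule eq_matI) (auto simp: grounded_laplacian_def laplacian_def degree_matrix_def adjacency_matrix_def)
  moreover have "{r, v} \<notin> E" if "r \<notin> {0..<n}" for r v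
    using assms(1) that by (auto simp: simple_graph_def doubleton_eq_iff)
  ultimately show ?thesis
    using grounded_laplacian_no_crossing[OF assms(1), of "{0..<n}" w] assms(2) by simp
qed

text \<open>
  The principal cofactors are the case of a single root.
\<close>

theorem matrix_tree:
  assumes "simple_graph {0..<n} E" "i < n"
  shows "det (mat_delete (laplacian n E w) i i) = weighted_tree_number {0..<n} E w"
proof -
  let ?M = "grounded_laplacian n E w ({0..<n} - {i})"
  have "det ?M = (\<Sum>j<n. ?M $$ (i, j) * cofactor ?M i j)"
    using assms(2) by (intro laplace_expansion_row) auto
  also have "\<dots> = (\<Sum>j<n. if j = i then cofactor ?M i i else 0)"
    using assms(2) by (intro sum.cong) (auto simp: grounded_laplacian_def)
  also have "\<dots> = det (mat_delete ?M i i)" using assms(2) by (simp add: cofactor_def)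
  also have "mat_delete ?M i i = mat_delete (laplacian n E w) i i"
    by (rule eq_matI)
      (use assms(2) in \<open>auto simp: mat_delete_def grounded_laplacian_def laplacian_def degree_matrix_def adjacency_matrix_def\<close>)
  finally show ?thesis
    using det_grounded_laplacian[OF assms(1), of "{0..<n} - {i}" w]
      weighted_tree_number_eq_forest_sum[OF assms(1), of i w] assms(2) by auto
qed

section \<open>The spectrum of the Laplacian\<close>

text \<open>
  Replacing the degree by the sum of the weights at \<open>i\<close> exhibits the action of the Laplacian as a
  weighted sum of differences, which makes its quadratic form a sum of squares.
\<close>

lemma laplacian_mult_vec:
  fixes x :: "nat \<Rightarrow> 'a :: {real_algebra_1, comm_ring_1}"
  assumes "simple_graph {0..<n} E" "i < n"
  shows "(\<Sum>j<n. of_real (laplacian n E w $$ (i, j)) * x j) =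
    (\<Sum>j<n. of_real (if {i, j} \<in> E then w {i, j} else 0) * (x i - x j))"
proof -
  let ?a = "\<lambda>j. if {i, j} \<in> E then w {i, j} else 0"
  have deg: "(\<Sum>e | e \<in> E \<and> i \<in> e. w e) = (\<Sum>j<n. ?a j)"
    using degree_eq_sum_neighbours[OF assms(1), of w i] by (simp add: atLeast0LessThan)
  have "(\<Sum>j<n. of_real (laplacian n E w $$ (i, j)) * x j) =
    (\<Sum>j<n. (if j = i then of_real (\<Sum>j<n. ?a j) * x i else 0) - of_real (?a j) * x j)"
    using assms(2) deg by (intro sum.cong) (auto simp: laplacian_index algebra_simps simp del: of_real_sum)
  also have "\<dots> = of_real (\<Sum>j<n. ?a j) * x i - (\<Sum>j<n. of_real (?a j) * x j)"
    using assms(2) by (simp add: sum_subtractf)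
  also have "\<dots> = (\<Sum>j<n. of_real (?a j) * (x i - x j))"
    by (simp only: of_real_sum sum_distrib_right right_diff_distrib sum_subtractf)
  finally show ?thesis .
qed

text \<open>
  With \<open>a i j\<close> the adjacency matrix and \<open>x\<close> an eigenvector, symmetrising the quadratic form gives
  \<open>2 z (\<Sum>\<^sub>i \<bar>x\<^sub>i\<bar>\<^sup>2) = \<Sum>\<^sub>i \<Sum>\<^sub>j a i j \<bar>x\<^sub>i - x\<^sub>j\<bar>\<^sup>2\<close>.  Reading this over the complex numbers shows
  at once that \<open>z\<close> is real and that it is nonnegative.
\<close>

lemma laplacian_complex_eigenvalue:
  assumes "weighted_graph {0..<n} E w" "eigenvalue (map_mat complex_of_real (laplacian n E w)) z"
  shows "\<exists>\<mu>\<ge>0. z = complex_of_real \<mu>"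
proof -
  let ?L = "map_mat complex_of_real (laplacian n E w)"
  define a where "a i j = (if {i, j} \<in> E then w {i, j} else 0)" for i j
  have a: "a i j \<ge> 0" "a i j = a j i" for i j
    using assms(1) by (auto simp: a_def weighted_graph_def insert_commute intro: less_imp_le)
  have dim: "dim_row (laplacian n E w) = n" "dim_col (laplacian n E w) = n"
    using laplacian_carrier by blast+
  obtain v where v: "v \<in> carrier_vec n" "v \<noteq> 0\<^sub>v n" "?L *\<^sub>v v = z \<cdot>\<^sub>v v"
    using assms(2) dim by (auto simp: eigenvalue_def eigenvector_def)
  define x where "x i = v $ i" for i
  have ev: "(\<Sum>j<n. of_real (a i j) * (x i - x j)) = z * x i" if "i < n" for i
  proof -
    have "(\<Sum>j<n. of_real (laplacian n E w $$ (i, j)) * x j) = (?L *\<^sub>v v) $ i"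
      using that v(1) dim by (simp add: scalar_prod_def x_def atLeast0LessThan)
    also have "\<dots> = z * x i" using v that by (simp add: x_def)
    finally show ?thesis
      using laplacian_mult_vec[of n E i w x] assms(1) that by (simp add: a_def weighted_graph_def)
  qed
  define N where "N = (\<Sum>i<n. (cmod (x i))\<^sup>2)"
  define Q where "Q = (\<Sum>i<n. \<Sum>j<n. a i j * (cmod (x i - x j))\<^sup>2)"
  let ?q = "\<Sum>i<n. \<Sum>j<n. of_real (a i j) * (x i - x j) * cnj (x i)"
  have "z * of_real N = (\<Sum>i<n. z * x i * cnj (x i))"
    by (simp add: N_def sum_distrib_left complex_norm_square mult.assoc del: of_real_power)
  also have "\<dots> = ?q"
    using ev by (intro sum.cong) (simp_all add: sum_distrib_right[symmetric])
  finally have zN: "z * of_real N = ?q" .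
  \<comment> \<open>Exchange the roles of i and j, using the symmetry of the weights.\<close>
  have "?q = (\<Sum>i<n. \<Sum>j<n. of_real (a i j) * (x j - x i) * cnj (x j))"
    by (subst sum.swap) (simp add: a(2))
  hence "2 * (z * of_real N) = ?q + (\<Sum>i<n. \<Sum>j<n. of_real (a i j) * (x j - x i) * cnj (x j))"
    using zN by simp
  also have "\<dots> = of_real Q"
    unfolding Q_def of_real_sum sum.distrib[symmetric] of_real_mult complex_norm_square
    by (intro sum.cong refl) (simp add: algebra_simps)
  finally have 2: "2 * (z * of_real N) = of_real Q" .
  obtain k where k: "k < n" "x k \<noteq> 0"
  proof -
    have "\<exists>k<n. v $ k \<noteq> 0"
    proof (rule ccontr)
      assume "\<not> ?thesis"
      hence "v = 0\<^sub>v n" using v(1) by (intro eq_vecI) auto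
      with v(2) show False ..
    qed
    thus ?thesis using that by (auto simp: x_def)
  qed
  have "N > 0" unfolding N_def
    by (rule sum_pos2[of _ k]) (use k in auto)
  moreover have "Q \<ge> 0" unfolding Q_def using a(1) by (intro sum_nonneg) simp
  moreover have "z = of_real (Q / (2 * N))" using 2 \<open>N > 0\<close> by (simp add: field_simps)
  ultimately show ?thesis by (intro exI[of _ "Q / (2 * N)"]) simp
qed

text \<open>
  The factorization over the complex numbers has real roots only, so it descends to the reals.
\<close>

lemma laplacian_char_poly_factorized:
  assumes "weighted_graph {0..<n} E w"
  shows "\<exists>M. char_poly (laplacian n E w) = (\<Prod>\<mu>\<in>#M. [:- \<mu>, 1:]) \<and> size M = n \<and> (\<forall>\<mu>\<in>#M. \<mu> \<ge> 0)"
proof -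
  interpret of_real_poly: map_poly_inj_comm_ring_hom complex_of_real ..
  let ?L = "laplacian n E w"
  have L: "map_mat complex_of_real ?L \<in> carrier_mat n n" by simp
  from char_poly_factorized[OF this] obtain zs
    where zs: "char_poly (map_mat complex_of_real ?L) = (\<Prod>z\<leftarrow>zs. [:- z, 1:])" "length zs = n"
    by blast
  have "\<exists>\<mu>\<ge>0. z = complex_of_real \<mu>" if "z \<in> set zs" for z
  proof -
    have "poly (\<Prod>z\<leftarrow>zs. [:- z, 1:]) z = 0"
      using that by (auto simp: poly_prod_list prod_list_zero_iff)
    hence "eigenvalue (map_mat complex_of_real ?L) z"
      using zs(1) eigenvalue_root_char_poly[OF L] by simp
    thus ?thesis by (rule laplacian_complex_eigenvalue[OF assms])
  qed
  hence re: "Re z \<ge> 0" "complex_of_real (Re z) = z" if "z \<in> set zs" for z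
    using that by fastforce+
  let ?ms = "map Re zs"
  have "map_poly complex_of_real (\<Prod>\<mu>\<leftarrow>?ms. [:- \<mu>, 1:]) = (\<Prod>z\<leftarrow>zs. [:- z, 1:])"
    using re by (auto simp: of_real_poly.hom_prod_list comp_def hom_distribs intro!: arg_cong[of _ _ prod_list])
  also have "\<dots> = map_poly complex_of_real (char_poly ?L)"
    unfolding zs(1)[symmetric] by (rule of_real_hom.char_poly_hom[OF laplacian_carrier])
  finally have "char_poly ?L = (\<Prod>\<mu>\<leftarrow>?ms. [:- \<mu>, 1:])"
    by (metis of_real_poly.injectivity)
  thus ?thesis using zs(2) re(1)
    by (intro exI[of _ "mset ?ms"]) (auto simp: multiset.map_comp simp flip: prod_mset_prod_list)
qed

lemma poly_char_poly_0:
  fixes A :: "'a :: field mat"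
  assumes "A \<in> carrier_mat n n"
  shows "poly (char_poly A) 0 = (-1) ^ n * det A"
proof -
  have "poly (char_poly A) 0 = det (- (char_matrix A 0))" using assms by (rule char_poly_matrix)
  also have "- (char_matrix A 0) = (-1) \<cdot>\<^sub>m A"
    using assms by (intro eq_matI) (auto simp: char_matrix_def)
  also have "det \<dots> = (-1) ^ n * det A" using assms by simp
  finally show ?thesis .
qed

text \<open>
  The derivative of the characteristic polynomial is the sum of the characteristic
  polynomials of the principal submatrices of size \<open>n - 1\<close>; at 0 each of them is, up to sign, the
  weighted number of spanning trees.
\<close>

lemma char_poly_laplacian_coeffs:
  assumes "simple_graph {0..<n} E" "n > 0"
  shows "poly (char_poly (laplacian n E w)) 0 = 0"
    and "poly (pderiv (char_poly (laplacian n E w))) 0 =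
      (-1) ^ (n - 1) * (real n * weighted_tree_number {0..<n} E w)"
proof -
  let ?L = "laplacian n E w"
  show "poly (char_poly ?L) 0 = 0"
    using poly_char_poly_0[OF laplacian_carrier, of n E w] det_laplacian[OF assms, of w] by simp
  have "poly (pderiv (char_poly ?L)) 0 = (\<Sum>i<n. poly (char_poly (mat_delete ?L i i)) 0)"
    by (simp add: pderiv_char_poly[OF laplacian_carrier] poly_sum)
  also have "\<dots> = (\<Sum>i<n. (-1) ^ (n - 1) * weighted_tree_number {0..<n} E w)"
    using matrix_tree[OF assms(1)]
    by (intro sum.cong) (simp_all add: poly_char_poly_0[OF mat_delete_carrier[OF laplacian_carrier]])
  finally show "poly (pderiv (char_poly ?L)) 0 =
      (-1) ^ (n - 1) * (real n * weighted_tree_number {0..<n} E w)" by simp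
qed

lemma poly_prod_mset_linear_0:
  "poly (\<Prod>\<mu>\<in>#M. [:- \<mu>, 1:]) 0 = (-1) ^ size M * (\<Prod>\<mu>\<in>#M. \<mu> :: real)"
  by (induction M) auto

lemma proots_prod_mset_linear:
  fixes M :: "'a :: idom multiset"
  shows "proots (\<Prod>\<mu>\<in>#M. [:- \<mu>, 1:]) = M"
proof (induction M)
  case (add x M)
  have "(\<Prod>\<mu>\<in>#M. [:- \<mu>, 1:]) \<noteq> 0" by (auto simp: prod_mset_zero_iff)
  with add show ?case by (simp add: proots_mult del: mult_pCons_left)
qed simp

text \<open>
  Splitting off one factor \<open>x\<close> from the characteristic polynomial, the linear coefficient is up to
  sign the product of the remaining roots.  By the matrix-tree theorem this product is a positive
  multiple of the number of trees, which forces the remaining roots to be positive.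
\<close>

lemma laplacian_spectrum:
  assumes G: "weighted_graph {0..<n} E w" and conn: "connected_graph {0..<n} E" and n: "n > 0"
  shows "\<exists>M. proots (char_poly (laplacian n E w)) = add_mset 0 M \<and> size M = n - 1 \<and>
    (\<forall>\<mu>\<in>#M. \<mu> > 0) \<and> \<Prod>\<^sub># M = real n * weighted_tree_number {0..<n} E w"
proof -
  let ?p = "char_poly (laplacian n E w)"
  obtain M' where M': "?p = (\<Prod>\<mu>\<in>#M'. [:- \<mu>, 1:])" "size M' = n" "\<forall>\<mu>\<in>#M'. \<mu> \<ge> 0"
    using laplacian_char_poly_factorized[OF G] by blast
  have simple: "simple_graph {0..<n} E" using G by (simp add: weighted_graph_def)
  note coeffs = char_poly_laplacian_coeffs[OF simple n, of w]
  have "0 \<in># M'"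
    using coeffs(1) unfolding M'(1) poly_prod_mset_linear_0 by (simp add: prod_mset_zero_iff)
  then obtain M where M: "M' = add_mset 0 M" by (metis multi_member_split)
  have sz: "size M = n - 1" using M M'(2) by simp
  have "?p = pCons 0 (\<Prod>\<mu>\<in>#M. [:- \<mu>, 1:])" using M'(1) M by simp
  hence "poly (pderiv ?p) 0 = poly (\<Prod>\<mu>\<in>#M. [:- \<mu>, 1:]) 0" by (simp add: pderiv_pCons)
  also have "\<dots> = (-1) ^ (n - 1) * \<Prod>\<^sub># M" using poly_prod_mset_linear_0[of M] sz by simp
  finally have prod: "\<Prod>\<^sub># M = real n * weighted_tree_number {0..<n} E w" using coeffs(2) by simp
  hence "\<Prod>\<^sub># M \<noteq> 0" using weighted_tree_number_pos[OF G conn] n by simp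
  hence "0 \<notin># M" by (simp add: prod_mset_zero_iff)
  hence pos: "\<forall>\<mu>\<in>#M. \<mu> > 0" using M'(3) M by (auto simp: less_le)
  have "proots ?p = add_mset 0 M" unfolding M'(1) M by (rule proots_prod_mset_linear)
  with sz pos prod show ?thesis by blast
qed

section \<open>The lower bound\<close>

text \<open>
  The inequality of the arithmetic and geometric means, applied to the reciprocals.
\<close>

lemma sum_list_inverse_ge:
  fixes xs :: "real list"
  assumes "\<And>x. x \<in> set xs \<Longrightarrow> x > 0" "xs \<noteq> []"
  shows "(\<Sum>x\<leftarrow>xs. inverse x) \<ge> real (length xs) / root (length xs) (prod_list xs)"
proof -
  let ?k = "length xs"
  have k: "?k > 0" using assms(2) by simp
  have pos: "inverse (xs ! i) > 0" if "i < ?k" for i using assms(1) that by simp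
  have P: "(\<Prod>i<?k. inverse (xs ! i)) = inverse (prod_list xs)"
    unfolding prod.list_conv_set_nth prod_inversef[symmetric] comp_def atLeast0LessThan ..
  have "prod_list xs > 0" using assms(1) by (induction xs) auto
  have "1 / root ?k (prod_list xs) = root ?k (\<Prod>i<?k. inverse (xs ! i))"
    using k P by (simp add: real_root_inverse divide_inverse)
  also have "\<dots> = (\<Prod>i<?k. inverse (xs ! i)) powr (1 / ?k)"
    using k P \<open>prod_list xs > 0\<close> by (subst root_powr_inverse) auto
  also have "\<dots> \<le> (\<Sum>i<?k. inverse (xs ! i) / ?k)"
    using arith_geom_mean[of "{..<?k}" "\<lambda>i. inverse (xs ! i)"] pos k by (auto intro: less_imp_le)
  also have "\<dots> = (\<Sum>x\<leftarrow>xs. inverse x) / ?k"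
    by (simp add: sum_list_sum_nth sum_divide_distrib atLeast0LessThan)
  finally show ?thesis using k by (simp add: field_simps)
qed

theorem theorem11:
  fixes n :: nat and E :: "nat set set" and w :: "nat set \<Rightarrow> real"
  assumes "2 \<le> n"
    and "weighted_graph {0..<n} E w"
    and "connected_graph {0..<n} E"
  shows "rho_ss_centering (laplacian n E w) \<ge>
    (real n - 1) / (2 * root (n - 1) (real n * weighted_tree_number {0..<n} E w))"
proof -
  let ?L = "laplacian n E w"
  obtain M where M: "proots (char_poly ?L) = add_mset 0 M" "size M = n - 1" "\<forall>\<mu>\<in>#M. \<mu> > 0"
    "\<Prod>\<^sub># M = real n * weighted_tree_number {0..<n} E w"
    using laplacian_spectrum[OF assms(2,3)] assms(1) by auto
  define xs where "xs = sorted_list_of_multiset M"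
  have xs: "mset xs = M" "sorted xs" by (simp_all add: xs_def)
  have len: "length xs = n - 1" using xs(1) M(2) by (metis size_mset)
  have pos: "x > 0" if "x \<in> set xs" for x using that xs(1) M(3) by auto
  \<comment> \<open>The eigenvalue 0 comes first, so the indices from 2 on enumerate xs.\<close>
  have "sorted_list_of_multiset (proots (char_poly ?L)) = 0 # xs"
    using pos by (simp add: M(1) insort_is_Cons less_imp_le flip: xs_def)
  hence eig: "eigval ?L i = xs ! (i - 2)" if "2 \<le> i" for i
    using that by (simp add: eigval_def nth_Cons' numeral_2_eq_2)
  have "dim_row ?L = n" using laplacian_carrier by blast
  hence "(\<Sum>i = 2..dim_row ?L. inverse (eigval ?L i)) = (\<Sum>i = 2..n. inverse (xs ! (i - 2)))"
    using eig by simp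
  also have "\<dots> = (\<Sum>i<n - 1. inverse (xs ! i))"
    by (rule sum.reindex_bij_witness[of _ "\<lambda>i. i + 2" "\<lambda>i. i - 2"]) auto
  also have "\<dots> = (\<Sum>x\<leftarrow>xs. inverse x)"
    by (simp add: sum_list_sum_nth len atLeast0LessThan)
  finally have rho: "rho_ss_centering ?L = (\<Sum>x\<leftarrow>xs. inverse x) / 2"
    by (simp add: rho_ss_centering_def)
  have "prod_list xs = real n * weighted_tree_number {0..<n} E w"
    using M(4) xs(1) by (metis prod_mset_prod_list)
  moreover have "xs \<noteq> []" using len assms(1) by auto
  ultimately have "(real n - 1) / root (n - 1) (real n * weighted_tree_number {0..<n} E w)
      \<le> (\<Sum>x\<leftarrow>xs. inverse x)"
    using sum_list_inverse_ge[OF pos, of xs] len assms(1) by (simp add: of_nat_diff)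
  hence "(real n - 1) / root (n - 1) (real n * weighted_tree_number {0..<n} E w) / 2
      \<le> rho_ss_centering ?L"
    unfolding rho by (rule divide_right_mono) simp
  thus ?thesis by (simp add: mult.commute)
qed

end
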